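(* For $1\le\iota\le n$ and $(r,s,i,j)\in\mu^{-1}(0)^{rss}$, let $G_\iota(r,s,i,j):=s'_{\iota\iota}$ be the $\iota$-th diagonal coordinate of $s'=\overline{bsb^{-1}}$, where $b\in B$ satisfies $b=\sum_{\nu=1}^nE_{\nu\nu}\,\mathrm{diag}(b)\,L^{\nu}$. Then $$G_\iota(r,s,i,j)=\left[\mathrm{tr}\Big(\prod_{1\le k\le n,\,k\neq\iota}l_k(r)\Big)\right]^{-1}\mathrm{tr}\Big(\prod_{1\le k\le n,\,k\ne\iota}l_k(r)\;s\Big),$$ and this is a $B$-invariant function.
   Context: Let $n\ge 1$, $\mathfrak{g}=\mathfrak{gl}_n(\mathbb{C})$, $B\subset GL_n(\mathbb{C})$ the group of invertible upper triangular matrices, $\mathfrak{b}$ the upper triangular matrices, $\mathfrak{u}\subset\mathfrak{g}$ the strictly upper triangular matrices. Identify $\mathfrak{b}^*\cong\mathfrak{g}/\mathfrak{u}$ via the trace pairing $(r,s)\mapsto\mathrm{tr}(rs)$; $\overline{v}$ is the class of $v$ in $\mathfrak{g}/\mathfrak{u}$; an element of $\mathfrak{b}^*$ has a unique lower triangular representative $s=(s_{\iota\gamma})$. $T^*(\mathfrak{b}\times\mathbb{C}^n)=\mathfrak{b}\times\mathfrak{b}^*\times\mathbb{C}^n\times(\mathbb{C}^n)^*$ has points $(r,s,i,j)$, $i$ a column vector and $j$ a row vector. $B$ acts by $b.(r,s,i,j)=(brb^{-1},\overline{bsb^{-1}},bi,jb^{-1})$. The moment map is $\mu(r,s,i,j)=\overline{[r,s]+ij}\in\mathfrak{b}^*$,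 and $\mu^{-1}(0)^{rss}$ is the set of $(r,s,i,j)\in\mu^{-1}(0)$ with $r$ having pairwise distinct eigenvalues. For $r=(r_{\iota\gamma})\in\mathfrak{b}$, $l_k(r)=r-r_{kk}I_n$ and $L^{\nu}=[\mathrm{tr}(\prod_{k\ne\nu}l_k(r))]^{-1}\prod_{k\neq\nu}l_k(r)$ (empty product is $I_n$). $\mathrm{diag}(a)$ is the diagonal matrix with the diagonal entries of $a$; $E_{\nu\nu}$ has $1$ in entry $(\nu,\nu)$ and $0$ elsewhere. The trace of an upper triangular matrix times $s\in\mathfrak{g}/\mathfrak{u}$ is well defined. *)

theory Defs
  imports "Jordan_Normal_Form.Spectral_Radius"
begin

text \<open>
  Matrices are those of Jordan_Normal_Form, so the size n is an ordinary natural number and row and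
  column indices run over \<open>0, \<dots>, n - 1\<close> instead of \<open>1, \<dots>, n\<close>.
\<close>

subsection \<open>Upper triangular matrices and the quotient by the strictly upper triangular ones\<close>

definition upper_tri :: "nat \<Rightarrow> complex mat set" where
  "upper_tri n = {r \<in> carrier_mat n n. upper_triangular r}"

definition strict_upper_tri :: "nat \<Rightarrow> complex mat set" where
  "strict_upper_tri n = {v \<in> carrier_mat n n. \<forall>i<n. \<forall>j\<le>i. v $$ (i, j) = 0}"

definition Borel_group :: "nat \<Rightarrow> complex mat set" where
  "Borel_group n = {b \<in> carrier_mat n n. invertible_mat b \<and> upper_triangular b}"

text \<open>Only used on invertible matrices; see \<open>inv_mat_Borel\<close> below.\<close>

definition inv_mat :: "complex mat \<Rightarrow> complex mat" where
  "inv_mat b = the (mat_inverse b)"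

definition mtrace :: "complex mat \<Rightarrow> complex" where
  "mtrace a = sum_list (diag_mat a)"

definition mod_u_rel :: "nat \<Rightarrow> (complex mat \<times> complex mat) set" where
  "mod_u_rel n = {(v, w). v \<in> carrier_mat n n \<and> w \<in> carrier_mat n n \<and> v - w \<in> strict_upper_tri n}"

abbreviation u_class :: "nat \<Rightarrow> complex mat \<Rightarrow> complex mat set" where
  "u_class n v \<equiv> mod_u_rel n `` {v}"

text \<open>
  The quotient of all matrices by the strictly upper triangular ones, which is the dual of
  \<^term>\<open>upper_tri n\<close> under the trace pairing \<open>dual_trace\<close>.
\<close>

definition dual_b :: "nat \<Rightarrow> complex mat set set" where
  "dual_b n = carrier_mat n n // mod_u_rel n"

text \<open>The trace of an upper triangular matrix times an element of the quotient; it is the same for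
  all representatives (\<open>dual_trace_class\<close>).\<close>

definition dual_trace :: "complex mat \<Rightarrow> complex mat set \<Rightarrow> complex" where
  "dual_trace a s = the_elem ((\<lambda>v. mtrace (a * v)) ` s)"

definition lower_rep :: "complex mat set \<Rightarrow> complex mat" where
  "lower_rep s = (THE v. v \<in> s \<and> upper_triangular (transpose_mat v))"

definition coord :: "complex mat set \<Rightarrow> nat \<Rightarrow> nat \<Rightarrow> complex" where
  "coord s i j = lower_rep s $$ (i, j)"


subsection \<open>The cotangent bundle, the action and the moment map\<close>

text \<open>Column vectors are \<open>n \<times> 1\<close> matrices and row vectors are \<open>1 \<times> n\<close> matrices.\<close>

type_synonym point = "complex mat \<times> complex mat set \<times> complex mat \<times> complex mat"

definition cotangent :: "nat \<Rightarrow> point set" where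
  "cotangent n = upper_tri n \<times> dual_b n \<times> carrier_mat n 1 \<times> carrier_mat 1 n"

text \<open>
  Maps out of the quotient are unions over all representatives, as in
  \<^theory>\<open>HOL.Equiv_Relations\<close>.
\<close>

definition dual_act :: "nat \<Rightarrow> complex mat \<Rightarrow> complex mat set \<Rightarrow> complex mat set" where
  "dual_act n b s = (\<Union>v\<in>s. u_class n (b * v * inv_mat b))"

definition act :: "nat \<Rightarrow> complex mat \<Rightarrow> point \<Rightarrow> point" where
  "act n b = (\<lambda>(r, s, i, j). (b * r * inv_mat b, dual_act n b s, b * i, j * inv_mat b))"

definition moment :: "nat \<Rightarrow> point \<Rightarrow> complex mat set" where
  "moment n = (\<lambda>(r, s, i, j). \<Union>v\<in>s. u_class n (r * v - v * r + i * j))"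

definition zero_fiber :: "nat \<Rightarrow> point set" where
  "zero_fiber n = {x \<in> cotangent n. moment n x = u_class n (0\<^sub>m n n)}"

definition zero_fiber_rss :: "nat \<Rightarrow> point set" where
  "zero_fiber_rss n = {(r, s, i, j) \<in> zero_fiber n. card (spectrum r) = n}"


subsection \<open>The diagonalizing matrices\<close>

definition l_mat :: "nat \<Rightarrow> complex mat \<Rightarrow> nat \<Rightarrow> complex mat" where
  "l_mat n r k = r - r $$ (k, k) \<cdot>\<^sub>m 1\<^sub>m n"

text \<open>The factors are polynomials in r and commute, so the order of multiplication is immaterial.\<close>

definition l_prod :: "nat \<Rightarrow> complex mat \<Rightarrow> nat \<Rightarrow> complex mat" where
  "l_prod n r \<nu> = foldr (\<lambda>k m. l_mat n r k * m) (filter (\<lambda>k. k \<noteq> \<nu>) [0..<n]) (1\<^sub>m n)"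

definition L_mat :: "nat \<Rightarrow> complex mat \<Rightarrow> nat \<Rightarrow> complex mat" where
  "L_mat n r \<nu> = inverse (mtrace (l_prod n r \<nu>)) \<cdot>\<^sub>m l_prod n r \<nu>"

definition diag_part :: "nat \<Rightarrow> complex mat \<Rightarrow> complex mat" where
  "diag_part n a = mat_diag n (\<lambda>k. a $$ (k, k))"

definition E_diag :: "nat \<Rightarrow> nat \<Rightarrow> complex mat" where
  "E_diag n \<nu> = mat_diag n (\<lambda>k. if k = \<nu> then 1 else 0)"

definition adapted :: "nat \<Rightarrow> complex mat \<Rightarrow> complex mat \<Rightarrow> bool" where
  "adapted n r b \<longleftrightarrow>
     b = foldr (\<lambda>\<nu> m. E_diag n \<nu> * diag_part n b * L_mat n r \<nu> + m) [0..<n] (0\<^sub>m n n)"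

definition G :: "nat \<Rightarrow> nat \<Rightarrow> point \<Rightarrow> complex" where
  "G n \<iota> = (\<lambda>(r, s, i, j).
     THE g. \<exists>b\<in>Borel_group n. adapted n r b \<and> g = coord (dual_act n b s) \<iota> \<iota>)"


subsection \<open>Independence of representatives\<close>

lemma mod_u_rel_iff:
  "(v, w) \<in> mod_u_rel n \<longleftrightarrow>
     v \<in> carrier_mat n n \<and> w \<in> carrier_mat n n \<and> (\<forall>i<n. \<forall>j\<le>i. v $$ (i, j) = w $$ (i, j))"
proof -
  have "v - w \<in> strict_upper_tri n \<longleftrightarrow> (\<forall>i<n. \<forall>j\<le>i. v $$ (i, j) = w $$ (i, j))"
    if vw: "v \<in> carrier_mat n n" "w \<in> carrier_mat n n"
  proof -
    have "(v - w) $$ (i, j) = 0 \<longleftrightarrow> v $$ (i, j) = w $$ (i, j)" if "i < n" "j \<le> i" for i j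
      using that vw by simp
    then show ?thesis using minus_carrier_mat[OF vw(2)] unfolding strict_upper_tri_def by blast
  qed
  then show ?thesis unfolding mod_u_rel_def by blast
qed

lemma equiv_mod_u_rel: "equiv (carrier_mat n n) (mod_u_rel n)"
proof (rule equivI)
  show "mod_u_rel n \<subseteq> carrier_mat n n \<times> carrier_mat n n"
    unfolding mod_u_rel_def by blast
  show "refl_on (carrier_mat n n) (mod_u_rel n)"
    unfolding refl_on_def mod_u_rel_iff by blast
  show "sym (mod_u_rel n)"
    by (rule symI) (metis mod_u_rel_iff)
  show "trans (mod_u_rel n)"
    by (rule transI) (metis mod_u_rel_iff)
qed

lemma inv_mat_Borel:
  assumes "b \<in> Borel_group n"
  shows "inv_mat b \<in> carrier_mat n n" "b * inv_mat b = 1\<^sub>m n" "inv_mat b * b = 1\<^sub>m n"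
proof -
  from assms have b: "b \<in> carrier_mat n n" and "invertible_mat b"
    by (auto simp: Borel_group_def)
  then obtain c where c: "b * c = 1\<^sub>m n" "c * b = 1\<^sub>m (dim_row c)"
    by (auto simp: invertible_mat_def inverts_mat_def)
  have "dim_col c = n" using arg_cong[OF c(1), of dim_col] by simp
  moreover have "dim_row c = n" using arg_cong[OF c(2), of dim_col] b by simp
  ultimately have "b \<in> Units (ring_mat TYPE(complex) n ())"
    using b c by (auto simp: Units_def ring_mat_simps intro!: bexI[of _ c])
  with mat_inverse(1)[OF b, where b = "()"] obtain d where "mat_inverse b = Some d"
    by (cases "mat_inverse b") auto
  with mat_inverse(2)[OF b this]
  show "inv_mat b \<in> carrier_mat n n" "b * inv_mat b = 1\<^sub>m n" "inv_mat b * b = 1\<^sub>m n"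
    by (auto simp: inv_mat_def)
qed

lemma upper_triangular_inv_mat:
  assumes b: "b \<in> Borel_group n"
  shows "upper_triangular (inv_mat b)"
proof -
  note c = inv_mat_Borel[OF b]
  from b have bc: "b \<in> carrier_mat n n" and ub: "upper_triangular b"
    by (auto simp: Borel_group_def)
  have prod: "(\<Sum>k\<in>{0..<n}. b $$ (i, k) * inv_mat b $$ (k, j)) = (if i = j then 1 else 0)"
    if "i < n" "j < n" for i j
    using arg_cong[OF c(2), of "\<lambda>m. m $$ (i, j)"] that bc c(1) by (simp add: scalar_prod_def)
  have "det b * det (inv_mat b) = 1"
    using det_mult[OF bc c(1)] c(2) by simp
  then have "0 \<notin> set (diag_mat b)"
    using upper_triangular_imp_det_eq_0_iff[OF bc ub] by auto
  then have nz: "b $$ (i, i) \<noteq> 0" if "i < n" for i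
    using that bc by (auto simp: diag_mat_def)
  have "\<forall>j<i. inv_mat b $$ (i, j) = 0" if "i < n" for i
    using that
  proof (induction "n - i" arbitrary: i rule: less_induct)
    case less
    show ?case
    proof (intro allI impI)
      fix j assume j: "j < i"
      have "(\<Sum>k\<in>{0..<n}. b $$ (i, k) * inv_mat b $$ (k, j))
          = (\<Sum>k\<in>{0..<n}. if k = i then b $$ (i, i) * inv_mat b $$ (i, j) else 0)"
      proof (rule sum.cong[OF refl])
        fix k assume k: "k \<in> {0..<n}"
        consider "k < i" | "k = i" | "i < k" by linarith
        then show "b $$ (i, k) * inv_mat b $$ (k, j)
            = (if k = i then b $$ (i, i) * inv_mat b $$ (i, j) else 0)"
        proof cases
          case 1
          then show ?thesis using upper_triangularD[OF ub, of k i] less.prems bc by auto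
        next
          case 3
          then have "inv_mat b $$ (k, j) = 0" using less.hyps[of k] k j by auto
          with 3 show ?thesis by simp
        qed simp
      qed
      then have "b $$ (i, i) * inv_mat b $$ (i, j) = 0"
        using prod[of i j] j less.prems by simp
      then show "inv_mat b $$ (i, j) = 0" using nz[OF less.prems] by simp
    qed
  qed
  then show ?thesis using c(1) by (intro upper_triangularI) auto
qed

lemma strict_upper_tri_mult_left:
  assumes a: "a \<in> upper_tri n" and v: "v \<in> strict_upper_tri n"
  shows "a * v \<in> strict_upper_tri n"
proof -
  have "a $$ (i, k) * v $$ (k, j) = 0" if "i < n" "j \<le> i" "k < n" for i j k
    using that a v upper_triangularD[of a k i]
    by (cases "k < i") (auto simp: upper_tri_def strict_upper_tri_def)
  then show ?thesis using a v
    by (auto simp: upper_tri_def strict_upper_tri_def scalar_prod_def intro!: sum.neutral)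
qed

lemma strict_upper_tri_mult_right:
  assumes a: "a \<in> upper_tri n" and v: "v \<in> strict_upper_tri n"
  shows "v * a \<in> strict_upper_tri n"
proof -
  have "v $$ (i, k) * a $$ (k, j) = 0" if "i < n" "j \<le> i" "k < n" for i j k
    using that a v upper_triangularD[of a j k]
    by (cases "k \<le> i") (auto simp: upper_tri_def strict_upper_tri_def)
  then show ?thesis using a v
    by (auto simp: upper_tri_def strict_upper_tri_def scalar_prod_def intro!: sum.neutral)
qed

lemma strict_upper_tri_minus:
  assumes "v \<in> strict_upper_tri n" "w \<in> strict_upper_tri n"
  shows "v - w \<in> strict_upper_tri n"
  using assms by (auto simp: strict_upper_tri_def)

lemma Borel_upper_tri:
  assumes "b \<in> Borel_group n"
  shows "b \<in> upper_tri n" "inv_mat b \<in> upper_tri n"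
  using assms upper_triangular_inv_mat[OF assms] inv_mat_Borel[OF assms]
  by (auto simp: Borel_group_def upper_tri_def)

lemma dual_act_class:
  assumes b: "b \<in> Borel_group n" and v: "v \<in> carrier_mat n n"
  shows "dual_act n b (u_class n v) = u_class n (b * v * inv_mat b)"
  unfolding dual_act_def
proof (rule UN_equiv_class[OF equiv_mod_u_rel _ v], rule congruentI)
  fix x y assume xy: "(x, y) \<in> mod_u_rel n"
  note bb = Borel_upper_tri[OF b]
  from xy have c: "x \<in> carrier_mat n n" "y \<in> carrier_mat n n" and d: "x - y \<in> strict_upper_tri n"
    by (auto simp: mod_u_rel_def)
  from bb have bc: "b \<in> carrier_mat n n" "inv_mat b \<in> carrier_mat n n" by (auto simp: upper_tri_def)
  have "b * (x - y) * inv_mat b = b * x * inv_mat b - b * y * inv_mat b"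
    using bc c by (simp add: mult_minus_distrib_mat[of _ n n] minus_mult_distrib_mat[of _ n n])
  moreover have "b * (x - y) * inv_mat b \<in> strict_upper_tri n"
    using strict_upper_tri_mult_right[OF bb(2) strict_upper_tri_mult_left[OF bb(1) d]] .
  ultimately have "(b * x * inv_mat b, b * y * inv_mat b) \<in> mod_u_rel n"
    using bc c by (auto simp: mod_u_rel_def)
  then show "u_class n (b * x * inv_mat b) = u_class n (b * y * inv_mat b)"
    by (rule equiv_class_eq[OF equiv_mod_u_rel])
qed

lemma moment_class:
  assumes r: "r \<in> upper_tri n" and v: "v \<in> carrier_mat n n"
    and i: "i \<in> carrier_mat n 1" and j: "j \<in> carrier_mat 1 n"
  shows "moment n (r, u_class n v, i, j) = u_class n (r * v - v * r + i * j)"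
  unfolding moment_def case_prod_conv
proof (rule UN_equiv_class[OF equiv_mod_u_rel _ v], rule congruentI)
  fix x y assume xy: "(x, y) \<in> mod_u_rel n"
  from xy have c: "x \<in> carrier_mat n n" "y \<in> carrier_mat n n" and d: "x - y \<in> strict_upper_tri n"
    by (auto simp: mod_u_rel_def)
  from r have rc: "r \<in> carrier_mat n n" by (simp add: upper_tri_def)
  have ij: "i * j \<in> carrier_mat n n" using i j by simp
  have m: "r * x \<in> carrier_mat n n" "r * y \<in> carrier_mat n n"
    "x * r \<in> carrier_mat n n" "y * r \<in> carrier_mat n n" using rc c by simp_all
  have diff: "(p - q + e) - (p' - q' + e) = (p - p') - (q - q')"
    if "p \<in> carrier_mat n n" "q \<in> carrier_mat n n" "p' \<in> carrier_mat n n"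
      "q' \<in> carrier_mat n n" "e \<in> carrier_mat n n" for p q p' q' e :: "complex mat"
    using that by (intro eq_matI) auto
  have "(r * x - x * r + i * j) - (r * y - y * r + i * j) = r * (x - y) - (x - y) * r"
    unfolding mult_minus_distrib_mat[OF rc c] minus_mult_distrib_mat[OF c rc]
    using diff[OF m(1,3,2,4) ij] .
  moreover have "r * (x - y) - (x - y) * r \<in> strict_upper_tri n"
    using strict_upper_tri_mult_left[OF r d] strict_upper_tri_mult_right[OF r d]
    by (rule strict_upper_tri_minus)
  ultimately have "(r * x - x * r + i * j, r * y - y * r + i * j) \<in> mod_u_rel n"
    using m ij by (auto simp: mod_u_rel_def)
  then show "u_class n (r * x - x * r + i * j) = u_class n (r * y - y * r + i * j)"
    by (rule equiv_class_eq[OF equiv_mod_u_rel])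
qed

lemma dual_trace_class:
  assumes a: "a \<in> upper_tri n" and v: "v \<in> carrier_mat n n"
  shows "dual_trace a (u_class n v) = mtrace (a * v)"
proof -
  have "mtrace (a * w) = mtrace (a * v)" if "w \<in> u_class n v" for w
  proof -
    from that have w: "w \<in> carrier_mat n n" and d: "v - w \<in> strict_upper_tri n"
      by (auto simp: mod_u_rel_def)
    have ac: "a \<in> carrier_mat n n" using a by (simp add: upper_tri_def)
    have "(a * v) $$ (k, k) = (a * w) $$ (k, k)" if k: "k < n" for k
    proof -
      have "(a * v - a * w) $$ (k, k) = 0"
        using strict_upper_tri_mult_left[OF a d] k mult_minus_distrib_mat[OF ac v w]
        by (simp add: strict_upper_tri_def)
      moreover have "(a * v - a * w) $$ (k, k) = (a * v) $$ (k, k) - (a * w) $$ (k, k)"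
        by (rule index_minus_mat(1)) (use k ac w in simp_all)
      ultimately show ?thesis by simp
    qed
    then have "map (\<lambda>k. (a * w) $$ (k, k)) [0..<n] = map (\<lambda>k. (a * v) $$ (k, k)) [0..<n]"
      by (intro map_cong refl) simp
    moreover have "dim_row (a * w) = n" "dim_row (a * v) = n" using ac by simp_all
    ultimately show ?thesis unfolding mtrace_def diag_mat_def by presburger
  qed
  then have "(\<lambda>w. mtrace (a * w)) ` u_class n v = (\<lambda>w. mtrace (a * v)) ` u_class n v"
    by (rule image_cong[OF refl])
  moreover have "v \<in> u_class n v" using v by (rule equiv_class_self[OF equiv_mod_u_rel])
  ultimately show ?thesis by (simp add: dual_trace_def image_constant)
qed

lemma lower_rep_class:
  assumes v: "v \<in> carrier_mat n n"
  shows "lower_rep (u_class n v) = mat n n (\<lambda>(i, j). if j \<le> i then v $$ (i, j) else 0)"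
proof -
  define m where "m = mat n n (\<lambda>(i, j). if j \<le> i then v $$ (i, j) else 0)"
  have mc: "m \<in> carrier_mat n n" by (simp add: m_def)
  have mi: "m $$ (i, j) = (if j \<le> i then v $$ (i, j) else 0)" if "i < n" "j < n" for i j
    using that by (simp add: m_def)
  have "v - m \<in> strict_upper_tri n"
    unfolding strict_upper_tri_def using v mc by (simp add: mi minus_carrier_mat)
  then have mem: "m \<in> u_class n v" using v mc by (simp add: mod_u_rel_def)
  have low: "upper_triangular (transpose_mat m)"
    by (rule upper_triangularI) (use mc in \<open>simp add: mi\<close>)
  have "w = m" if w: "w \<in> u_class n v" and u: "upper_triangular (transpose_mat w)" for w
  proof -
    from w have wc: "w \<in> carrier_mat n n" and d: "v - w \<in> strict_upper_tri n"
      by (auto simp: mod_u_rel_def)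
    have "w $$ (i, j) = m $$ (i, j)" if ij: "i < n" "j < n" for i j
    proof (cases "j \<le> i")
      case True
      then have "(v - w) $$ (i, j) = 0" using d ij by (simp add: strict_upper_tri_def)
      then show ?thesis using True ij v wc by (simp add: mi)
    next
      case False
      then show ?thesis using upper_triangularD[OF u, of i j] ij wc by (simp add: mi)
    qed
    then show ?thesis using wc mc by (intro eq_matI) auto
  qed
  then have "lower_rep (u_class n v) = m"
    unfolding lower_rep_def using mem low by blast
  then show ?thesis by (simp only: m_def)
qed

end

theory Submission
  imports Defs
begin

text \<open>
  Write \<open>P\<^sub>\<nu>\<close> for the product of the \<open>r - r\<^sub>k\<^sub>k\<close> over \<open>k \<noteq> \<nu>\<close>. For an upper triangular \<open>r\<close> the product over
  all \<open>k\<close> vanishes, so \<open>P\<^sub>\<nu>\<close> is annihilated by \<open>r - r\<^sub>\<nu>\<^sub>\<nu>\<close>: each nonzero row of \<open>P\<^sub>\<nu>\<close> is a left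
  eigenvector of \<open>r\<close> for \<open>r\<^sub>\<nu>\<^sub>\<nu>\<close>. The equation that defines an adapted \<open>b\<close> says that row \<open>\<nu>\<close> of
  \<open>b\<close> is a multiple of row \<open>\<nu>\<close> of \<open>L\<^sup>\<nu>\<close>. Hence \<open>b r = D b\<close> with \<open>D\<close> the diagonal part of \<open>r\<close> (\<open>adapted_diagonalizes\<close>). Taking the
  rows with factor 1 gives an adapted \<open>b\<close> that is unitriangular, hence in the Borel group
  (\<open>adapted_exists\<close>).

  Any relation \<open>b r = r' b\<close> between matrices with the same diagonal carries over to \<open>P\<^sub>\<nu>\<close>
  (\<open>lin_prod_intertwine\<close>). For an adapted \<open>b\<close> the matrix \<open>r'\<close> is \<open>D\<close>, and \<open>P\<^sub>\<nu>(D)\<close> is the matrix unit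
  \<open>E\<^sub>\<nu>\<^sub>\<nu>\<close> times \<open>c = tr P\<^sub>\<nu>(r)\<close>, which is nonzero because the eigenvalues are distinct. Therefore

  \<open>tr (P\<^sub>\<nu>(r) s) = tr (b P\<^sub>\<nu>(r) s b\<inverse>) = tr (P\<^sub>\<nu>(D) b s b\<inverse>) = c (b s b\<inverse>)\<^sub>\<nu>\<^sub>\<nu>\<close>,

  which is the formula and shows at the same time that the choice of \<open>b\<close> does not matter
  (\<open>coord_adapted\<close>). For the invariance, take \<open>r' = b r b\<inverse>\<close> with any \<open>b\<close> in the Borel group:
  conjugation by an upper triangular matrix keeps the diagonal, so \<open>P\<^sub>\<nu>(r') = b P\<^sub>\<nu>(r) b\<inverse>\<close>
  (\<open>l_prod_conj\<close>), and the traces in the formula do not change.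
\<close>

section \<open>Products of the linear factors\<close>

text \<open>
  Indexing by a list instead of by the omitted index makes the partial products and the product of
  all factors available for inductions and splittings.
\<close>
definition lin_prod :: "nat \<Rightarrow> complex mat \<Rightarrow> nat list \<Rightarrow> complex mat" where
  "lin_prod n r ks = foldr (\<lambda>k m. l_mat n r k * m) ks (1\<^sub>m n)"

lemma l_prod_eq_lin_prod: "l_prod n r \<nu> = lin_prod n r (filter (\<lambda>k. k \<noteq> \<nu>) [0..<n])"
  by (simp add: l_prod_def lin_prod_def)

lemma lin_prod_Nil [simp]: "lin_prod n r [] = 1\<^sub>m n"
  and lin_prod_Cons [simp]: "lin_prod n r (k # ks) = l_mat n r k * lin_prod n r ks"
  by (simp_all add: lin_prod_def)

lemma l_mat_carrier [simp]: "r \<in> carrier_mat n n \<Longrightarrow> l_mat n r k \<in> carrier_mat n n"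
  by (simp add: l_mat_def minus_carrier_mat)

lemma lin_prod_carrier [simp]: "r \<in> carrier_mat n n \<Longrightarrow> lin_prod n r ks \<in> carrier_mat n n"
  by (induction ks) (simp_all add: mult_carrier_mat[of _ n n])

lemma l_prod_carrier [simp]: "r \<in> carrier_mat n n \<Longrightarrow> l_prod n r \<nu> \<in> carrier_mat n n"
  by (simp add: l_prod_eq_lin_prod)

lemma lin_prod_append:
  assumes "r \<in> carrier_mat n n"
  shows "lin_prod n r (ks @ ls) = lin_prod n r ks * lin_prod n r ls"
  using assms
  by (induction ks) (simp_all add: assoc_mult_mat[of _ n n _ n _ n] left_mult_one_mat[of _ n n])

lemma l_mat_mult:
  assumes "r \<in> carrier_mat n n" "a \<in> carrier_mat n n"
  shows "l_mat n r k * a = r * a - r $$ (k, k) \<cdot>\<^sub>m a"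
    and "a * l_mat n r k = a * r - r $$ (k, k) \<cdot>\<^sub>m a"
  using assms
  by (simp_all add: l_mat_def mult_minus_distrib_mat[of _ n n] minus_mult_distrib_mat[of _ n n]
      mult_smult_assoc_mat[of _ n n _ n] mult_smult_distrib[of _ n n _ n])

text \<open>
  One relation \<open>b r = r' b\<close> moves \<open>b\<close> through all factors, provided that the scalars subtracted on
  both sides agree. It serves three times: with \<open>r'\<close> diagonal, with \<open>r'\<close> a conjugate of \<open>r\<close>, and with
  \<open>r' = r\<close> and \<open>b\<close> a linear factor, where it says that the factors commute.
\<close>
lemma lin_prod_intertwine:
  assumes r: "r \<in> carrier_mat n n" and r': "r' \<in> carrier_mat n n" and b: "b \<in> carrier_mat n n"
    and comm: "b * r = r' * b" and diag: "\<And>k. k \<in> set ks \<Longrightarrow> r' $$ (k, k) = r $$ (k, k)"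
  shows "b * lin_prod n r ks = lin_prod n r' ks * b"
  using diag
proof (induction ks)
  case Nil
  show ?case using b by simp
next
  case (Cons k ks)
  have "b * l_mat n r k = l_mat n r' k * b"
    using Cons.prems[of k] comm r r' b by (simp add: l_mat_mult[of _ n b])
  then have "b * lin_prod n r (k # ks) = l_mat n r' k * (b * lin_prod n r ks)"
    using r r' b by (simp flip: assoc_mult_mat[of _ n n _ n _ n])
  also have "\<dots> = lin_prod n r' (k # ks) * b"
    using Cons r r' b by (simp add: assoc_mult_mat[of _ n n _ n _ n])
  finally show ?case .
qed

lemma lin_prod_comm_l_mat:
  assumes r: "r \<in> carrier_mat n n"
  shows "l_mat n r k * lin_prod n r ks = lin_prod n r ks * l_mat n r k"
proof (rule lin_prod_intertwine)
  show "l_mat n r k * r = r * l_mat n r k"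
    using r by (simp add: l_mat_mult)
qed (use r in simp_all)

section \<open>Upper triangular matrices\<close>

lemma upper_tri_mult:
  assumes a: "a \<in> upper_tri n" and b: "b \<in> upper_tri n"
  shows "a * b \<in> upper_tri n"
    and "\<And>k. k < n \<Longrightarrow> (a * b) $$ (k, k) = a $$ (k, k) * b $$ (k, k)"
proof -
  from a b have c: "a \<in> carrier_mat n n" "b \<in> carrier_mat n n"
    and u: "upper_triangular a" "upper_triangular b"
    by (auto simp: upper_tri_def)
  have e: "a $$ (i, k) * b $$ (k, j) = 0" if "i < n" "k < n" "j \<le> i" "\<not> (i = k \<and> k = j)" for i j k
    using that c upper_triangularD[OF u(1), of k i] upper_triangularD[OF u(2), of j k]
    by (cases "k < i") auto
  have ent: "(a * b) $$ (i, j) = (\<Sum>k\<in>{0..<n}. a $$ (i, k) * b $$ (k, j))" if "i < n" "j < n" for i j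
    using that c by (simp add: scalar_prod_def)
  show "a * b \<in> upper_tri n"
    unfolding upper_tri_def using c
    by (auto intro!: upper_triangularI sum.neutral e simp: scalar_prod_def)
  show "(a * b) $$ (k, k) = a $$ (k, k) * b $$ (k, k)" if k: "k < n" for k
  proof -
    have "(\<Sum>m\<in>{0..<n}. a $$ (k, m) * b $$ (m, k)) = (\<Sum>m\<in>{k}. a $$ (k, m) * b $$ (m, k))"
      by (rule sum.mono_neutral_right) (use k e[of k _ k] in auto)
    then show ?thesis using ent[OF k k] by simp
  qed
qed

lemma l_mat_upper_tri:
  assumes "r \<in> upper_tri n"
  shows "l_mat n r k \<in> upper_tri n"
  using assms upper_triangularD[of r]
  by (auto simp: upper_tri_def l_mat_def minus_carrier_mat intro!: upper_triangularI)

lemma l_mat_diag: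
  assumes "r \<in> carrier_mat n n" "i < n"
  shows "l_mat n r k $$ (i, i) = r $$ (i, i) - r $$ (k, k)"
  using assms by (simp add: l_mat_def)

lemma lin_prod_upper_tri:
  assumes r: "r \<in> upper_tri n"
  shows "lin_prod n r ks \<in> upper_tri n"
    and "i < n \<Longrightarrow> lin_prod n r ks $$ (i, i) = (\<Prod>k\<leftarrow>ks. r $$ (i, i) - r $$ (k, k))"
proof (induction ks)
  case Nil
  { case 1 show ?case by (simp add: upper_tri_def) }
  { case 2 then show ?case by simp }
next
  case (Cons k ks)
  { case 1 show ?case using upper_tri_mult(1)[OF l_mat_upper_tri[OF r] Cons(1)] by simp }
  { case 2
    then show ?case using upper_tri_mult(2)[OF l_mat_upper_tri[OF r] Cons(1) 2] Cons(2)[OF 2]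
        l_mat_diag[of r n i k] r by (simp add: upper_tri_def) }
qed

text \<open>
  The first \<open>m\<close> unit vectors span an \<open>r\<close>-stable flag, and \<open>r - r\<^sub>k\<^sub>k\<close> maps the span of the unit vectors up
  to \<open>k\<close> into the span of those before \<open>k\<close>. So the product of the first \<open>m\<close> factors, taken in this
  order, kills the first \<open>m\<close> unit vectors. This is the Cayley-Hamilton theorem for triangular
  matrices, in a form suited to induction.
\<close>
lemma lin_prod_upt_columns_zero:
  assumes r: "r \<in> upper_tri n" and m: "m \<le> n" and i: "i < n" and j: "j < m"
  shows "lin_prod n r [0..<m] $$ (i, j) = 0"
  using m i j
proof (induction m arbitrary: i j)
  case (Suc m)
  have rc: "r \<in> carrier_mat n n" and ru: "upper_triangular r" using r by (auto simp: upper_tri_def)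
  have "lin_prod n r [0..<Suc m] = lin_prod n r [0..<m] * l_mat n r m"
    using rc by (simp add: lin_prod_append right_mult_one_mat[of _ n n])
  then have "lin_prod n r [0..<Suc m] $$ (i, j)
      = (\<Sum>k\<in>{0..<n}. lin_prod n r [0..<m] $$ (i, k) * l_mat n r m $$ (k, j))"
    using Suc.prems rc l_mat_carrier[OF rc, of m] lin_prod_carrier[OF rc, of "[0..<m]"]
    by (simp add: scalar_prod_def del: l_mat_carrier lin_prod_carrier)
  also have "\<dots> = 0"
  proof (rule sum.neutral, rule ballI)
    fix k assume k: "k \<in> {0..<n}"
    show "lin_prod n r [0..<m] $$ (i, k) * l_mat n r m $$ (k, j) = 0"
      \<comment> \<open>For \<open>k < m\<close> the induction hypothesis applies to column \<open>k\<close> of the shorter product; the only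
        other row in which column \<open>j\<close> of the last factor could be nonzero is \<open>k = j = m\<close>, and there the
        subtracted scalar cancels the diagonal entry.\<close>
    proof (cases "k < m")
      case True
      then show ?thesis using Suc by simp
    next
      case False
      then have "l_mat n r m $$ (k, j) = 0"
        using k Suc.prems rc upper_triangularD[OF ru, of j k] by (cases "j = k") (auto simp: l_mat_def less_Suc_eq)
      then show ?thesis by simp
    qed
  qed
  finally show ?case .
qed simp

lemma lin_prod_all_zero:
  assumes r: "r \<in> upper_tri n"
  shows "lin_prod n r [0..<n] = 0\<^sub>m n n"
proof -
  have "lin_prod n r [0..<n] \<in> carrier_mat n n" using r by (simp add: upper_tri_def)
  then show ?thesis using lin_prod_upt_columns_zero[OF r le_refl] by (intro eq_matI) auto
qed

text \<open>The missing factor can be moved into its place because the factors commute.\<close>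
lemma l_prod_mult_l_mat:
  assumes r: "r \<in> upper_tri n" and \<nu>: "\<nu> < n"
  shows "l_prod n r \<nu> * l_mat n r \<nu> = 0\<^sub>m n n"
proof -
  have rc: "r \<in> carrier_mat n n" using r by (simp add: upper_tri_def)
  define ks where "ks = [0..<\<nu>]"
  define ls where "ls = [Suc \<nu>..<n]"
  have split: "[0..<n] = ks @ \<nu> # ls"
    using \<nu> upt_add_eq_append[of 0 \<nu> "n - \<nu>"] upt_conv_Cons[OF \<nu>] by (simp add: ks_def ls_def)
  have "filter (\<lambda>k. k \<noteq> \<nu>) [0..<n] = ks @ ls"
    unfolding split by (auto simp: ks_def ls_def filter_id_conv)
  then have "l_prod n r \<nu> * l_mat n r \<nu> = lin_prod n r ks * (lin_prod n r ls * l_mat n r \<nu>)"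
    using rc by (simp add: l_prod_eq_lin_prod lin_prod_append assoc_mult_mat[of _ n n _ n _ n])
  also have "\<dots> = lin_prod n r [0..<n]"
    unfolding split using rc by (simp add: lin_prod_append lin_prod_comm_l_mat)
  finally show ?thesis using lin_prod_all_zero[OF r] by simp
qed

text \<open>The rows of \<open>P\<^sub>\<nu>\<close> are left eigenvectors or zero; this is what makes adapted matrices diagonalize.\<close>
lemma l_prod_mult_self:
  assumes r: "r \<in> upper_tri n" and \<nu>: "\<nu> < n"
  shows "l_prod n r \<nu> * r = r $$ (\<nu>, \<nu>) \<cdot>\<^sub>m l_prod n r \<nu>"
proof -
  have rc: "r \<in> carrier_mat n n" using r by (simp add: upper_tri_def)
  have pc: "l_prod n r \<nu> \<in> carrier_mat n n" using rc by simp
  have "l_prod n r \<nu> * l_mat n r \<nu> = l_prod n r \<nu> * r - r $$ (\<nu>, \<nu>) \<cdot>\<^sub>m l_prod n r \<nu>"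
    using rc pc by (rule l_mat_mult(2))
  then have z: "l_prod n r \<nu> * r - r $$ (\<nu>, \<nu>) \<cdot>\<^sub>m l_prod n r \<nu> = 0\<^sub>m n n"
    using l_prod_mult_l_mat[OF r \<nu>] by simp
  have prc: "l_prod n r \<nu> * r \<in> carrier_mat n n" using pc rc by (rule mult_carrier_mat)
  show ?thesis
  proof (rule eq_matI)
    fix i j assume "i < dim_row (r $$ (\<nu>, \<nu>) \<cdot>\<^sub>m l_prod n r \<nu>)" "j < dim_col (r $$ (\<nu>, \<nu>) \<cdot>\<^sub>m l_prod n r \<nu>)"
    then have ij: "i < n" "j < n" using pc by auto
    have "(l_prod n r \<nu> * r - r $$ (\<nu>, \<nu>) \<cdot>\<^sub>m l_prod n r \<nu>) $$ (i, j) = 0"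
      using z ij by simp
    then show "(l_prod n r \<nu> * r) $$ (i, j) = (r $$ (\<nu>, \<nu>) \<cdot>\<^sub>m l_prod n r \<nu>) $$ (i, j)"
      using ij pc prc by (subst (asm) index_minus_mat(1)) auto
  qed (use prc pc in auto)
qed

section \<open>Traces\<close>

lemma mtrace_sum:
  assumes "a \<in> carrier_mat n n"
  shows "mtrace a = (\<Sum>k\<in>{0..<n}. a $$ (k, k))"
  using assms by (simp add: mtrace_def diag_mat_def sum_list_distinct_conv_sum_set)

lemma mtrace_mult_comm:
  assumes "a \<in> carrier_mat n n" "b \<in> carrier_mat n n"
  shows "mtrace (a * b) = mtrace (b * a)"
proof -
  have "mtrace (a * b) = (\<Sum>i\<in>{0..<n}. \<Sum>k\<in>{0..<n}. a $$ (i, k) * b $$ (k, i))"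
    using assms by (simp add: mtrace_sum[of _ n] scalar_prod_def)
  also have "\<dots> = (\<Sum>k\<in>{0..<n}. \<Sum>i\<in>{0..<n}. b $$ (k, i) * a $$ (i, k))"
    by (subst sum.swap) (simp add: mult.commute)
  also have "\<dots> = mtrace (b * a)"
    using assms by (simp add: mtrace_sum[of _ n] scalar_prod_def)
  finally show ?thesis .
qed

lemma mtrace_conj:
  assumes a: "a \<in> carrier_mat n n" and b: "b \<in> Borel_group n"
  shows "mtrace (b * a * inv_mat b) = mtrace a"
proof -
  note i = inv_mat_Borel[OF b]
  have bc: "b \<in> carrier_mat n n" using b by (simp add: Borel_group_def)
  have "mtrace (b * a * inv_mat b) = mtrace (inv_mat b * (b * a))"
    using a bc i(1) by (intro mtrace_mult_comm[of _ n]) simp_all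
  also have "inv_mat b * (b * a) = a"
    using a bc i by (simp flip: assoc_mult_mat[of _ n n _ n _ n])
  finally show ?thesis .
qed

text \<open>
  On the diagonal, every entry of \<open>P\<^sub>\<nu>\<close> other than the one at \<open>\<nu>\<close> contains a factor \<open>r\<^sub>k\<^sub>k - r\<^sub>k\<^sub>k\<close>.
\<close>
lemma mtrace_l_prod:
  assumes r: "r \<in> upper_tri n" and \<nu>: "\<nu> < n"
  shows "mtrace (l_prod n r \<nu>) = l_prod n r \<nu> $$ (\<nu>, \<nu>)"
proof -
  have z: "l_prod n r \<nu> $$ (k, k) = 0" if "k < n" "k \<noteq> \<nu>" for k
    using that lin_prod_upper_tri(2)[OF r that(1), of "filter (\<lambda>k. k \<noteq> \<nu>) [0..<n]"]
    by (auto simp: l_prod_eq_lin_prod prod_list_zero_iff)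
  have "mtrace (l_prod n r \<nu>) = (\<Sum>k\<in>{0..<n}. l_prod n r \<nu> $$ (k, k))"
    using r by (intro mtrace_sum) (simp add: upper_tri_def)
  also have "\<dots> = (\<Sum>k\<in>{\<nu>}. l_prod n r \<nu> $$ (k, k))"
    using \<nu> z by (intro sum.mono_neutral_right) auto
  finally show ?thesis by simp
qed

lemma mtrace_l_prod_nonzero:
  assumes r: "r \<in> upper_tri n" and \<nu>: "\<nu> < n" and inj: "inj_on (\<lambda>k. r $$ (k, k)) {0..<n}"
  shows "mtrace (l_prod n r \<nu>) \<noteq> 0"
proof -
  have "l_prod n r \<nu> $$ (\<nu>, \<nu>) = (\<Prod>k\<leftarrow>filter (\<lambda>k. k \<noteq> \<nu>) [0..<n]. r $$ (\<nu>, \<nu>) - r $$ (k, k))"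
    unfolding l_prod_eq_lin_prod by (rule lin_prod_upper_tri(2)[OF r \<nu>])
  also have "\<dots> \<noteq> 0" using inj \<nu> by (auto simp: prod_list_zero_iff inj_on_def)
  finally show ?thesis using mtrace_l_prod[OF r \<nu>] by simp
qed

section \<open>Adapted matrices diagonalize\<close>

lemma L_mat_carrier [simp]: "r \<in> carrier_mat n n \<Longrightarrow> L_mat n r \<nu> \<in> carrier_mat n n"
  by (simp add: L_mat_def)

text \<open>
  Multiplication by \<open>E\<^sub>\<nu>\<^sub>\<nu>\<close> from the left selects row \<open>\<nu>\<close>, so the matrix equation decouples into one
  condition for each row.
\<close>
lemma adapted_iff:
  assumes b: "b \<in> carrier_mat n n" and r: "r \<in> carrier_mat n n"
  shows "adapted n r b \<longleftrightarrow>
    (\<forall>i<n. \<forall>j<n. b $$ (i, j) = b $$ (i, i) * L_mat n r i $$ (i, j))"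
proof -
  define T where "T = (\<lambda>\<nu>. E_diag n \<nu> * diag_part n b * L_mat n r \<nu>)"
  have Tc: "T \<nu> \<in> carrier_mat n n" for \<nu>
    using r by (simp add: T_def E_diag_def diag_part_def mult_carrier_mat[of _ n n])
  have Te: "T \<nu> $$ (i, j) = (if i = \<nu> then b $$ (i, i) * L_mat n r i $$ (i, j) else 0)"
    if "i < n" "j < n" for i j \<nu>
    using that L_mat_carrier[OF r, of \<nu>]
    by (simp add: T_def E_diag_def diag_part_def mat_diag_mult_left[of _ n n] del: L_mat_carrier)
  have fold: "foldr (\<lambda>\<nu> m. T \<nu> + m) xs (0\<^sub>m n n) \<in> carrier_mat n n \<and>
     (\<forall>i<n. \<forall>j<n. foldr (\<lambda>\<nu> m. T \<nu> + m) xs (0\<^sub>m n n) $$ (i, j) = (\<Sum>\<nu>\<leftarrow>xs. T \<nu> $$ (i, j)))"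
    for xs
  proof (induction xs)
    case (Cons x xs)
    then show ?case using Tc[of x] by (auto simp: index_add_mat)
  qed simp
  define F where "F = foldr (\<lambda>\<nu> m. T \<nu> + m) [0..<n] (0\<^sub>m n n)"
  have Fc: "F \<in> carrier_mat n n" using fold[of "[0..<n]"] by (simp add: F_def)
  have Fe: "F $$ (i, j) = b $$ (i, i) * L_mat n r i $$ (i, j)" if "i < n" "j < n" for i j
    using that fold[of "[0..<n]"]
    by (simp add: F_def Te sum_list_distinct_conv_sum_set)
  have "adapted n r b \<longleftrightarrow> b = F" by (simp add: adapted_def F_def T_def)
  also have "\<dots> \<longleftrightarrow> (\<forall>i<n. \<forall>j<n. b $$ (i, j) = F $$ (i, j))"
    using b Fc by (auto intro!: eq_matI)
  finally show ?thesis using Fe by simp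
qed

text \<open>
  Row \<open>i\<close> of the witness is row \<open>i\<close> of \<open>L\<^sup>i\<close>. The normalization of \<open>L\<^sup>i\<close> by the trace of \<open>P\<^sub>i\<close>, which is the
  entry of \<open>P\<^sub>i\<close> at \<open>(i, i)\<close>, makes the diagonal entries 1.
\<close>
lemma adapted_exists:
  assumes r: "r \<in> upper_tri n" and inj: "inj_on (\<lambda>k. r $$ (k, k)) {0..<n}"
  shows "\<exists>b\<in>Borel_group n. adapted n r b"
proof -
  have rc: "r \<in> carrier_mat n n" using r by (simp add: upper_tri_def)
  define b where "b = mat n n (\<lambda>(i, j). L_mat n r i $$ (i, j))"
  have bc: "b \<in> carrier_mat n n" by (simp add: b_def)
  have be: "b $$ (i, j) = L_mat n r i $$ (i, j)" if "i < n" "j < n" for i j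
    using that by (simp add: b_def)
  have b1: "b $$ (i, i) = 1" if i: "i < n" for i
    using i mtrace_l_prod[OF r i] mtrace_l_prod_nonzero[OF r i inj] l_prod_carrier[OF rc, of i]
    by (simp add: be L_mat_def del: l_prod_carrier)
  have bu: "upper_triangular b"
  proof (rule upper_triangularI)
    fix i j assume ij: "j < i" "i < dim_row b"
    then have "l_prod n r i $$ (i, j) = 0"
      using bc lin_prod_upper_tri(1)[OF r, of "filter (\<lambda>k. k \<noteq> i) [0..<n]"]
        upper_triangularD[of "l_prod n r i" j i]
      by (auto simp: l_prod_eq_lin_prod upper_tri_def)
    then show "b $$ (i, j) = 0" using ij bc l_prod_carrier[OF rc, of i]
      by (simp add: be L_mat_def del: l_prod_carrier)
  qed
  have "0 \<notin> set (diag_mat b)" using bc b1 by (auto simp: diag_mat_def)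
  then have "det b \<noteq> 0" using upper_triangular_imp_det_eq_0_iff[OF bc bu] by simp
  then have "invertible_mat b" using bc det_non_zero_imp_unit[OF bc, of "()"]
    by (auto simp: Units_def ring_mat_simps invertible_mat_def inverts_mat_def square_mat.simps)
  then have "b \<in> Borel_group n" using bc bu by (simp add: Borel_group_def)
  moreover have "adapted n r b" unfolding adapted_iff[OF bc rc] using b1 be by simp
  ultimately show ?thesis by blast
qed

text \<open>Row \<open>i\<close> of \<open>b\<close> is a multiple of a row of \<open>P\<^sub>i\<close>, on which \<open>r\<close> acts from the right as \<open>r\<^sub>i\<^sub>i\<close>.\<close>
lemma adapted_diagonalizes:
  assumes r: "r \<in> upper_tri n" and b: "b \<in> carrier_mat n n" and ad: "adapted n r b"
  shows "b * r = diag_part n r * b"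
proof -
  have rc: "r \<in> carrier_mat n n" using r by (simp add: upper_tri_def)
  have ade: "b $$ (i, j) = b $$ (i, i) * L_mat n r i $$ (i, j)" if "i < n" "j < n" for i j
    using ad that unfolding adapted_iff[OF b rc] by blast
  have Lr: "L_mat n r i * r = r $$ (i, i) \<cdot>\<^sub>m L_mat n r i" if i: "i < n" for i
    using l_prod_mult_self[OF r i] l_prod_carrier[OF rc, of i] rc
    by (simp add: L_mat_def mult_smult_assoc_mat[of _ n n _ n] del: l_prod_carrier)
       (auto intro!: eq_matI)
  show ?thesis
  proof (rule eq_matI)
    fix i j assume "i < dim_row (diag_part n r * b)" "j < dim_col (diag_part n r * b)"
    then have ij: "i < n" "j < n" using b by (auto simp: diag_part_def mat_diag_def)
    have "(b * r) $$ (i, j) = (\<Sum>k\<in>{0..<n}. b $$ (i, k) * r $$ (k, j))"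
      using ij b rc by (simp add: scalar_prod_def)
    also have "\<dots> = (\<Sum>k\<in>{0..<n}. b $$ (i, i) * (L_mat n r i $$ (i, k) * r $$ (k, j)))"
      using ij by (intro sum.cong refl) (subst ade, auto)
    also have "\<dots> = b $$ (i, i) * (L_mat n r i * r) $$ (i, j)"
      using ij rc L_mat_carrier[OF rc, of i]
      by (simp add: scalar_prod_def sum_distrib_left del: L_mat_carrier)
    also have "\<dots> = r $$ (i, i) * b $$ (i, j)"
      using ij L_mat_carrier[OF rc, of i] ade[OF ij]
      by (simp add: Lr[OF ij(1)] del: L_mat_carrier)
    also have "\<dots> = (diag_part n r * b) $$ (i, j)"
      using ij b by (simp add: diag_part_def mat_diag_mult_left[of _ n n])
    finally show "(b * r) $$ (i, j) = (diag_part n r * b) $$ (i, j)" .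
  qed (use b rc in \<open>auto simp: diag_part_def mat_diag_def\<close>)
qed

lemma lin_prod_diag:
  "set ks \<subseteq> {0..<n} \<Longrightarrow> lin_prod n (mat_diag n d) ks = mat_diag n (\<lambda>i. \<Prod>k\<leftarrow>ks. d i - d k)"
proof (induction ks)
  case Nil
  show ?case by simp
next
  case (Cons k ks)
  then have "l_mat n (mat_diag n d) k = mat_diag n (\<lambda>i. d i - d k)"
    by (auto simp: l_mat_def mat_diag_def intro!: eq_matI)
  with Cons show ?case by simp
qed

text \<open>
  Conjugation by \<open>b\<close> turns \<open>P\<^sub>\<nu>\<close> into a multiple of the matrix unit at \<open>(\<nu>, \<nu>)\<close>: in the product for
  the diagonal part of \<open>r\<close> only the diagonal entry at \<open>\<nu>\<close> survives.
\<close>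
lemma adapted_l_prod:
  assumes r: "r \<in> upper_tri n" and b: "b \<in> carrier_mat n n" and ad: "adapted n r b" and \<nu>: "\<nu> < n"
  shows "b * l_prod n r \<nu> = mat_diag n (\<lambda>k. if k = \<nu> then mtrace (l_prod n r \<nu>) else 0) * b"
proof -
  let ?ks = "filter (\<lambda>k. k \<noteq> \<nu>) [0..<n]"
  have rc: "r \<in> carrier_mat n n" using r by (simp add: upper_tri_def)
  have "b * l_prod n r \<nu> = lin_prod n (diag_part n r) ?ks * b"
    unfolding l_prod_eq_lin_prod
    by (rule lin_prod_intertwine[OF rc _ b adapted_diagonalizes[OF r b ad]])
      (auto simp: diag_part_def mat_diag_def)
  also have "lin_prod n (diag_part n r) ?ks
      = mat_diag n (\<lambda>i. \<Prod>k\<leftarrow>?ks. r $$ (i, i) - r $$ (k, k))"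
    unfolding diag_part_def by (rule lin_prod_diag) auto
  also have "\<dots> = mat_diag n (\<lambda>k. if k = \<nu> then mtrace (l_prod n r \<nu>) else 0)"
    using mtrace_l_prod[OF r \<nu>] lin_prod_upper_tri(2)[OF r \<nu>, of ?ks]
    by (auto simp: mat_diag_def l_prod_eq_lin_prod prod_list_zero_iff intro!: eq_matI)
  finally show ?thesis .
qed

section \<open>The trace formula\<close>

lemma coord_class:
  assumes "v \<in> carrier_mat n n" "k < n"
  shows "coord (u_class n v) k k = v $$ (k, k)"
  using assms by (simp add: coord_def lower_rep_class)

lemma dual_b_cases:
  assumes "s \<in> dual_b n"
  obtains v where "v \<in> carrier_mat n n" "s = u_class n v"
  using assms unfolding dual_b_def by (rule quotientE)

text \<open>
  The right-hand side does not mention \<open>b\<close>: this single computation gives the closed formula and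
  the independence of the choice of the adapted matrix.
\<close>
lemma coord_adapted:
  assumes r: "r \<in> upper_tri n" and inj: "inj_on (\<lambda>k. r $$ (k, k)) {0..<n}"
    and s: "s \<in> dual_b n" and b: "b \<in> Borel_group n" and ad: "adapted n r b" and \<iota>: "\<iota> < n"
  shows "coord (dual_act n b s) \<iota> \<iota>
    = inverse (mtrace (l_prod n r \<iota>)) * dual_trace (l_prod n r \<iota>) s"
proof -
  obtain v where v: "v \<in> carrier_mat n n" and sv: "s = u_class n v" using s by (rule dual_b_cases)
  have rc: "r \<in> carrier_mat n n" using r by (simp add: upper_tri_def)
  have bc: "b \<in> carrier_mat n n" using b by (simp add: Borel_group_def)
  note ic = inv_mat_Borel(1)[OF b]
  define p where "p = l_prod n r \<iota>"
  have pc: "p \<in> carrier_mat n n" using rc by (simp add: p_def)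
  have pu: "p \<in> upper_tri n" unfolding p_def l_prod_eq_lin_prod by (rule lin_prod_upper_tri(1)[OF r])
  define w where "w = b * v * inv_mat b"
  have wc: "w \<in> carrier_mat n n" using bc ic v by (simp add: w_def mult_carrier_mat[of _ n n])
  define C where "C = mat_diag n (\<lambda>k. if k = \<iota> then mtrace p else 0)"
  have Cc: "C \<in> carrier_mat n n" by (simp add: C_def)
  have "dual_trace p s = mtrace (p * v)" unfolding sv by (rule dual_trace_class[OF pu v])
  also have "\<dots> = mtrace (b * (p * v) * inv_mat b)"
    using mtrace_conj[OF mult_carrier_mat[OF pc v] b] by simp
  also have "b * (p * v) * inv_mat b = b * p * v * inv_mat b"
    using bc pc v ic by (simp add: assoc_mult_mat[of _ n n _ n _ n])
  also have "b * p = C * b"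
    unfolding C_def p_def by (rule adapted_l_prod[OF r bc ad \<iota>])
  also have "C * b * v * inv_mat b = C * w"
    using bc Cc v ic by (simp add: w_def assoc_mult_mat[of _ n n _ n _ n] mult_carrier_mat[of _ n n])
  also have "mtrace (C * w) = (\<Sum>k\<in>{0..<n}. (if k = \<iota> then mtrace p else 0) * w $$ (k, k))"
    using wc by (subst mtrace_sum[of _ n]) (simp_all add: C_def mat_diag_mult_left[of _ n n])
  also have "\<dots> = (\<Sum>k\<in>{0..<n}. if k = \<iota> then mtrace p * w $$ (k, k) else 0)"
    by (intro sum.cong) auto
  also have "\<dots> = mtrace p * w $$ (\<iota>, \<iota>)" using \<iota> by simp
  finally have "dual_trace p s = mtrace p * w $$ (\<iota>, \<iota>)" .
  moreover have "coord (dual_act n b s) \<iota> \<iota> = w $$ (\<iota>, \<iota>)"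
    unfolding sv dual_act_class[OF b v] w_def[symmetric] by (rule coord_class[OF wc \<iota>])
  moreover have "mtrace p \<noteq> 0" unfolding p_def by (rule mtrace_l_prod_nonzero[OF r \<iota> inj])
  ultimately show ?thesis by (simp add: p_def)
qed

text \<open>The spectrum of a triangular matrix is the set of its diagonal entries.\<close>
lemma inj_diag_if_card_spectrum:
  assumes r: "r \<in> upper_tri n" and card: "card (spectrum r) = n"
  shows "inj_on (\<lambda>k. r $$ (k, k)) {0..<n}"
proof -
  have rc: "r \<in> carrier_mat n n" and ru: "upper_triangular r" using r by (auto simp: upper_tri_def)
  have "spectrum r = (\<lambda>k. r $$ (k, k)) ` {0..<n}"
    unfolding spectrum_root_char_poly[OF rc] char_poly_upper_triangular[OF rc ru]
    using rc by (auto simp: poly_prod_list diag_mat_def)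
  then show ?thesis using card by (intro eq_card_imp_inj_on) auto
qed

lemma zero_fiber_rss_cases:
  assumes "(r, s, i, j) \<in> zero_fiber_rss n"
  obtains v where "r \<in> upper_tri n" "v \<in> carrier_mat n n" "s = u_class n v"
    "i \<in> carrier_mat n 1" "j \<in> carrier_mat 1 n"
    "u_class n (r * v - v * r + i * j) = u_class n (0\<^sub>m n n)" "card (spectrum r) = n"
    "inj_on (\<lambda>k. r $$ (k, k)) {0..<n}"
proof -
  from assms have r: "r \<in> upper_tri n" and s: "s \<in> dual_b n" and i: "i \<in> carrier_mat n 1"
    and j: "j \<in> carrier_mat 1 n" and m: "moment n (r, s, i, j) = u_class n (0\<^sub>m n n)"
    and c: "card (spectrum r) = n"
    by (auto simp: zero_fiber_rss_def zero_fiber_def cotangent_def)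
  obtain v where v: "v \<in> carrier_mat n n" "s = u_class n v" using s by (rule dual_b_cases)
  show thesis
    using that[OF r v i j _ c inj_diag_if_card_spectrum[OF r c]] m moment_class[OF r v(1) i j] v(2)
    by simp
qed

text \<open>
  The definite description in \<^const>\<open>G\<close> denotes because an adapted matrix exists and all of them give
  the same value.
\<close>
lemma G_formula:
  assumes x: "(r, s, i, j) \<in> zero_fiber_rss n" and \<iota>: "\<iota> < n"
  shows "\<exists>b\<in>Borel_group n. adapted n r b"
    and "G n \<iota> (r, s, i, j) = inverse (mtrace (l_prod n r \<iota>)) * dual_trace (l_prod n r \<iota>) s"
    and "b \<in> Borel_group n \<Longrightarrow> adapted n r b \<Longrightarrow>
      coord (dual_act n b s) \<iota> \<iota> = inverse (mtrace (l_prod n r \<iota>)) * dual_trace (l_prod n r \<iota>) s"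
proof -
  from x have s: "s \<in> dual_b n" by (auto simp: zero_fiber_rss_def zero_fiber_def cotangent_def)
  obtain r: "r \<in> upper_tri n" and inj: "inj_on (\<lambda>k. r $$ (k, k)) {0..<n}"
    using x by (rule zero_fiber_rss_cases)
  show ex: "\<exists>b\<in>Borel_group n. adapted n r b" by (rule adapted_exists[OF r inj])
  show co: "coord (dual_act n b s) \<iota> \<iota>
      = inverse (mtrace (l_prod n r \<iota>)) * dual_trace (l_prod n r \<iota>) s"
    if "b \<in> Borel_group n" "adapted n r b" for b
    by (rule coord_adapted[OF r inj s that \<iota>])
  show "G n \<iota> (r, s, i, j) = inverse (mtrace (l_prod n r \<iota>)) * dual_trace (l_prod n r \<iota>) s"
    unfolding G_def case_prod_conv
  proof (rule the_equality)
    show "\<exists>b\<in>Borel_group n. adapted n r b \<and>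
        inverse (mtrace (l_prod n r \<iota>)) * dual_trace (l_prod n r \<iota>) s = coord (dual_act n b s) \<iota> \<iota>"
      using ex co by metis
  qed (use co in blast)
qed

section \<open>Equivariance under the Borel group\<close>

lemma upper_tri_conj:
  assumes r: "r \<in> upper_tri n" and b: "b \<in> Borel_group n"
  shows "b * r * inv_mat b \<in> upper_tri n"
    and "k < n \<Longrightarrow> (b * r * inv_mat b) $$ (k, k) = r $$ (k, k)"
proof -
  note bb = Borel_upper_tri[OF b]
  note br = upper_tri_mult[OF bb(1) r]
  note bi = upper_tri_mult(2)[OF bb]
  show "b * r * inv_mat b \<in> upper_tri n" by (rule upper_tri_mult(1)[OF br(1) bb(2)])
  assume k: "k < n"
  have "b $$ (k, k) * inv_mat b $$ (k, k) = 1" using bi[OF k] inv_mat_Borel(2)[OF b] k by simp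
  then show "(b * r * inv_mat b) $$ (k, k) = r $$ (k, k)"
    unfolding upper_tri_mult(2)[OF br(1) bb(2) k] br(2)[OF k]
    by (metis mult.assoc mult.commute mult.left_neutral)
qed

lemma conj_mult:
  assumes b: "b \<in> Borel_group n" and z: "z \<in> carrier_mat n n" and y: "y \<in> carrier_mat n n"
  shows "(b * z * inv_mat b) * (b * y * inv_mat b) = b * (z * y) * inv_mat b"
proof -
  note ic = inv_mat_Borel[OF b]
  have bc: "b \<in> carrier_mat n n" using b by (simp add: Borel_group_def)
  have "(b * z * inv_mat b) * (b * y * inv_mat b) = b * z * (inv_mat b * b * y * inv_mat b)"
    using bc ic(1) y z by (simp add: assoc_mult_mat[of _ n n _ n _ n])
  also have "\<dots> = b * (z * y) * inv_mat b"
    using bc ic y z by (simp add: assoc_mult_mat[of _ n n _ n _ n])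
  finally show ?thesis .
qed

lemma act_class:
  assumes "b \<in> Borel_group n" "v \<in> carrier_mat n n"
  shows "act n b (r, u_class n v, i, j)
    = (b * r * inv_mat b, u_class n (b * v * inv_mat b), b * i, j * inv_mat b)"
  using assms by (simp add: act_def dual_act_class)

text \<open>
  Each of the three terms of the moment map is conjugated by \<open>b\<close>, and the class of the result depends
  only on the class of the argument.
\<close>
lemma moment_act:
  assumes b: "b \<in> Borel_group n" and r: "r \<in> upper_tri n" and v: "v \<in> carrier_mat n n"
    and i: "i \<in> carrier_mat n 1" and j: "j \<in> carrier_mat 1 n"
  shows "moment n (act n b (r, u_class n v, i, j)) = dual_act n b (moment n (r, u_class n v, i, j))"
proof -
  have rc: "r \<in> carrier_mat n n" using r by (simp add: upper_tri_def)
  have bc: "b \<in> carrier_mat n n" using b by (simp add: Borel_group_def)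
  note ic = inv_mat_Borel(1)[OF b]
  have c: "r * v \<in> carrier_mat n n" "v * r \<in> carrier_mat n n" "i * j \<in> carrier_mat n n"
    using rc v i j by simp_all
  have ij: "(b * i) * (j * inv_mat b) = b * (i * j) * inv_mat b"
  proof -
    have "(b * i) * (j * inv_mat b) = b * i * j * inv_mat b"
      using bc i j ic by (intro assoc_mult_mat[symmetric, of _ n 1 _ n _ n]) auto
    also have "b * i * j = b * (i * j)" using bc i j by (rule assoc_mult_mat)
    finally show ?thesis .
  qed
  have "moment n (act n b (r, u_class n v, i, j))
      = u_class n (b * r * inv_mat b * (b * v * inv_mat b) - b * v * inv_mat b * (b * r * inv_mat b)
          + (b * i) * (j * inv_mat b))"
    unfolding act_class[OF b v]
    by (rule moment_class[OF upper_tri_conj(1)[OF r b]]) (use bc ic v i j in auto)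
  also have "\<dots> = u_class n (b * (r * v) * inv_mat b - b * (v * r) * inv_mat b
      + b * (i * j) * inv_mat b)"
    unfolding conj_mult[OF b rc v] conj_mult[OF b v rc] ij ..
  also have "\<dots> = u_class n (b * (r * v - v * r + i * j) * inv_mat b)"
    using bc ic c
    by (simp add: mult_minus_distrib_mat[of _ n n _ n] minus_mult_distrib_mat[of _ n n]
        mult_add_distrib_mat[of _ n n _ n] add_mult_distrib_mat[of _ n n] minus_carrier_mat
        mult_carrier_mat[of _ n n] del: assoc_mult_mat)
  also have "\<dots> = dual_act n b (u_class n (r * v - v * r + i * j))"
    using c by (intro dual_act_class[OF b, symmetric]) auto
  finally show ?thesis unfolding moment_class[OF r v i j] .
qed

text \<open>
  Equivariance of the moment map preserves the zero fiber, since the zero class is fixed, and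
  conjugation preserves the spectrum.
\<close>
lemma act_zero_fiber_rss:
  assumes b: "b \<in> Borel_group n" and x: "(r, s, i, j) \<in> zero_fiber_rss n"
  shows "act n b (r, s, i, j) \<in> zero_fiber_rss n"
proof -
  obtain v where r: "r \<in> upper_tri n" and v: "v \<in> carrier_mat n n" and s: "s = u_class n v"
    and i: "i \<in> carrier_mat n 1" and j: "j \<in> carrier_mat 1 n"
    and m: "u_class n (r * v - v * r + i * j) = u_class n (0\<^sub>m n n)" and card: "card (spectrum r) = n"
    using x by (rule zero_fiber_rss_cases)
  have rc: "r \<in> carrier_mat n n" using r by (simp add: upper_tri_def)
  have bc: "b \<in> carrier_mat n n" using b by (simp add: Borel_group_def)
  note ic = inv_mat_Borel[OF b]
  have "moment n (act n b (r, s, i, j)) = dual_act n b (u_class n (0\<^sub>m n n))"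
    unfolding s moment_act[OF b r v i j] moment_class[OF r v i j] m ..
  also have "\<dots> = u_class n (0\<^sub>m n n)"
    using bc ic(1) by (simp add: dual_act_class[OF b] right_mult_zero_mat[of _ n n]
        left_mult_zero_mat[of _ n n])
  finally have mom: "moment n (act n b (r, s, i, j)) = u_class n (0\<^sub>m n n)" .
  have rc': "b * r * inv_mat b \<in> carrier_mat n n" using bc rc ic(1) by simp
  have "similar_mat (b * r * inv_mat b) r"
    by (rule similar_matI[of _ _ b "inv_mat b" n]) (use bc rc rc' ic in auto)
  then have "spectrum (b * r * inv_mat b) = spectrum r"
    unfolding spectrum_root_char_poly[OF rc] spectrum_root_char_poly[OF rc']
    by (simp add: char_poly_similar)
  moreover have "act n b (r, s, i, j) \<in> cotangent n"
    using upper_tri_conj(1)[OF r b] bc ic(1) v i j unfolding s act_class[OF b v]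
    by (auto simp: cotangent_def dual_b_def intro!: quotientI)
  ultimately show ?thesis
    using mom card by (simp add: zero_fiber_rss_def zero_fiber_def act_def)
qed

lemma l_prod_conj:
  assumes r: "r \<in> upper_tri n" and b: "b \<in> Borel_group n"
  shows "l_prod n (b * r * inv_mat b) \<nu> = b * l_prod n r \<nu> * inv_mat b"
proof -
  have rc: "r \<in> carrier_mat n n" using r by (simp add: upper_tri_def)
  have bc: "b \<in> carrier_mat n n" using b by (simp add: Borel_group_def)
  note ic = inv_mat_Borel[OF b]
  define r' where "r' = b * r * inv_mat b"
  have rc': "r' \<in> carrier_mat n n" using bc rc ic(1) by (simp add: r'_def)
  have "b * l_prod n r \<nu> = l_prod n r' \<nu> * b"
    unfolding l_prod_eq_lin_prod
  proof (rule lin_prod_intertwine[OF rc rc' bc])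
    show "b * r = r' * b"
      unfolding r'_def using bc rc ic by (simp add: assoc_mult_mat[of _ n n _ n _ n])
  qed (use upper_tri_conj(2)[OF r b] in \<open>simp add: r'_def\<close>)
  then have "b * l_prod n r \<nu> * inv_mat b = l_prod n r' \<nu> * (b * inv_mat b)"
    using bc ic(1) l_prod_carrier[OF rc'] by (simp add: assoc_mult_mat[of _ n n _ n _ n])
  then show ?thesis
    using ic(2) l_prod_carrier[OF rc', of \<nu>] by (simp add: r'_def right_mult_one_mat[of _ n n])
qed

text \<open>
  The formula for \<open>G\<close> consists of traces of products of \<open>P\<^sub>\<iota>\<close> and \<open>s\<close>, which are conjugated
  simultaneously.
\<close>
lemma G_act:
  assumes b: "b \<in> Borel_group n" and x: "(r, s, i, j) \<in> zero_fiber_rss n" and \<iota>: "\<iota> < n"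
  shows "G n \<iota> (act n b (r, s, i, j)) = G n \<iota> (r, s, i, j)"
proof -
  obtain v where r: "r \<in> upper_tri n" and v: "v \<in> carrier_mat n n" and s: "s = u_class n v"
    using x by (rule zero_fiber_rss_cases)
  have rc: "r \<in> carrier_mat n n" using r by (simp add: upper_tri_def)
  have bc: "b \<in> carrier_mat n n" using b by (simp add: Borel_group_def)
  note ic = inv_mat_Borel(1)[OF b]
  have pu: "l_prod n q \<iota> \<in> upper_tri n" if "q \<in> upper_tri n" for q
    unfolding l_prod_eq_lin_prod by (rule lin_prod_upper_tri(1)[OF that])
  have pc: "l_prod n r \<iota> \<in> carrier_mat n n" using rc by simp
  have vc: "b * v * inv_mat b \<in> carrier_mat n n" using bc v ic by simp
  have "dual_trace (l_prod n (b * r * inv_mat b) \<iota>) (u_class n (b * v * inv_mat b))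
      = mtrace ((b * l_prod n r \<iota> * inv_mat b) * (b * v * inv_mat b))"
    using dual_trace_class[OF pu[OF upper_tri_conj(1)[OF r b]] vc] by (simp add: l_prod_conj[OF r b])
  also have "\<dots> = mtrace (l_prod n r \<iota> * v)"
    unfolding conj_mult[OF b pc v] using pc v by (intro mtrace_conj[OF _ b]) simp
  also have "\<dots> = dual_trace (l_prod n r \<iota>) s"
    unfolding s by (rule dual_trace_class[OF pu[OF r] v, symmetric])
  finally have "dual_trace (l_prod n (b * r * inv_mat b) \<iota>) (u_class n (b * v * inv_mat b))
      = dual_trace (l_prod n r \<iota>) s" .
  moreover have "mtrace (l_prod n (b * r * inv_mat b) \<iota>) = mtrace (l_prod n r \<iota>)"
    unfolding l_prod_conj[OF r b] by (rule mtrace_conj[OF pc b])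
  moreover have "(b * r * inv_mat b, u_class n (b * v * inv_mat b), b * i, j * inv_mat b)
      \<in> zero_fiber_rss n"
    using act_zero_fiber_rss[OF b x] unfolding s act_class[OF b v] .
  ultimately show ?thesis
    using G_formula(2)[OF _ \<iota>] x unfolding s act_class[OF b v] by simp
qed

theorem proposition6p9:
  fixes n \<iota> :: nat
  assumes "n \<ge> 1" and "\<iota> < n"
  shows "(\<forall>(r, s, i, j) \<in> zero_fiber_rss n.
            (\<exists>b\<in>Borel_group n. adapted n r b) \<and>
            (\<forall>b\<in>Borel_group n. adapted n r b \<longrightarrow>
               G n \<iota> (r, s, i, j) = coord (dual_act n b s) \<iota> \<iota>) \<and>
            G n \<iota> (r, s, i, j) =
              inverse (mtrace (l_prod n r \<iota>)) * dual_trace (l_prod n r \<iota>) s) \<and>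
         (\<forall>b\<in>Borel_group n. \<forall>x\<in>zero_fiber_rss n.
            act n b x \<in> zero_fiber_rss n \<and> G n \<iota> (act n b x) = G n \<iota> x)"
proof (intro conjI ballI)
  fix x assume x: "x \<in> zero_fiber_rss n"
  obtain r s i j where xe: "x = (r, s, i, j)" by (cases x)
  show "case x of (r, s, i, j) \<Rightarrow>
      (\<exists>b\<in>Borel_group n. adapted n r b) \<and>
      (\<forall>b\<in>Borel_group n. adapted n r b \<longrightarrow> G n \<iota> (r, s, i, j) = coord (dual_act n b s) \<iota> \<iota>) \<and>
      G n \<iota> (r, s, i, j) = inverse (mtrace (l_prod n r \<iota>)) * dual_trace (l_prod n r \<iota>) s"
    using G_formula[OF x[unfolded xe] \<open>\<iota> < n\<close>] unfolding xe by simp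
next
  fix b x assume b: "b \<in> Borel_group n" and x: "x \<in> zero_fiber_rss n"
  obtain r s i j where xe: "x = (r, s, i, j)" by (cases x)
  show "act n b x \<in> zero_fiber_rss n"
    using act_zero_fiber_rss[OF b x[unfolded xe]] by (simp add: xe)
  show "G n \<iota> (act n b x) = G n \<iota> x"
    using G_act[OF b x[unfolded xe] \<open>\<iota> < n\<close>] by (simp add: xe)
qed

end
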